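(* Let $G$ be a simple connected graph with vertices $v_1,\dots,v_n$ and adjacency matrix $\mathbf{A}=\mathbf{A}(G)$, and suppose the first two labelled vertices $v_1$ and $v_2$ are twin vertices. Let $a=0$ if $v_1,v_2$ are duplicates and $a=1$ if they are co-duplicates, and let $h_{1,2}=h_{1,2}(\lambda)$ denote the entry in row $1$ and column $2$ of $\operatorname{adj}(\lambda\mathbf{I}-\mathbf{A})$. Then $$\phi(\mathbf{A}(G),\lambda)=(\lambda+a)\left[\phi(\mathbf{A}(G_{-v_1}),\lambda)-h_{1,2}\right].$$
   Context: The adjacency matrix has $(i,j)$ entry $1$ if $v_i,v_j$ are adjacent and $0$ otherwise. Two distinct vertices are twins if they are duplicates (non-adjacent with the same neighbours) or co-duplicates (adjacent, and duplicate vertices in the complement of $G$, i.e. with the same neighbours among the remaining vertices). For a square matrix $\mathbf{M}$, $\phi(\mathbf{M},\lambda)=\det(\lambda\mathbf{I}-\mathbf{M})$ is its characteristic polynomial, and $\operatorname{adj}$ denotes the adjugate matrix. $G_{-v}$ is the graph obtained from $G$ by deleting vertex $v$ and its incident edges. *)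

theory Defs
  imports
    "Graph_Theory.Digraph_Component"
    "Jordan_Normal_Form.Char_Poly"
begin

text \<open>
  A finite simple graph is a \<^const>\<open>graph\<close> of the library: each edge is represented by a pair of
  opposite arcs, and the adjacency relation is
  \<^term>\<open>u \<rightarrow>\<^bsub>G\<^esub> v\<close>. Loops and parallel arcs are excluded.
\<close>

definition neighbours :: "('a, 'b) pre_digraph \<Rightarrow> 'a \<Rightarrow> 'a set" where
  "neighbours G u = {w \<in> verts G. u \<rightarrow>\<^bsub>G\<^esub> w}"

definition complement :: "('a, 'b) pre_digraph \<Rightarrow> ('a, 'a \<times> 'a) pre_digraph" where
  "complement G =
     \<lparr> verts = verts G,
       arcs = {(u, v). u \<in> verts G \<and> v \<in> verts G \<and> u \<noteq> v \<and> \<not> u \<rightarrow>\<^bsub>G\<^esub> v},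
       tail = fst,
       head = snd \<rparr>"

definition duplicates :: "('a, 'b) pre_digraph \<Rightarrow> 'a \<Rightarrow> 'a \<Rightarrow> bool" where
  "duplicates G u v \<longleftrightarrow>
     u \<in> verts G \<and> v \<in> verts G \<and> u \<noteq> v \<and> \<not> u \<rightarrow>\<^bsub>G\<^esub> v \<and> neighbours G u = neighbours G v"

definition co_duplicates :: "('a, 'b) pre_digraph \<Rightarrow> 'a \<Rightarrow> 'a \<Rightarrow> bool" where
  "co_duplicates G u v \<longleftrightarrow> u \<rightarrow>\<^bsub>G\<^esub> v \<and> duplicates (complement G) u v"

definition twins :: "('a, 'b) pre_digraph \<Rightarrow> 'a \<Rightarrow> 'a \<Rightarrow> bool" where
  "twins G u v \<longleftrightarrow> duplicates G u v \<or> co_duplicates G u v"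

definition vertex_labelling :: "('a, 'b) pre_digraph \<Rightarrow> 'a list \<Rightarrow> bool" where
  "vertex_labelling G vs \<longleftrightarrow> distinct vs \<and> set vs = verts G"

text \<open>Rows and columns are indexed from 0, following the order of the labelling \<open>vs\<close>.\<close>

definition adjacency_matrix :: "('a, 'b) pre_digraph \<Rightarrow> 'a list \<Rightarrow> real mat" where
  "adjacency_matrix G vs =
     mat (length vs) (length vs) (\<lambda>(i, j). if vs ! i \<rightarrow>\<^bsub>G\<^esub> vs ! j then 1 else 0)"

lemma adj_complement_iff:
  "u \<rightarrow>\<^bsub>complement G\<^esub> v \<longleftrightarrow> u \<in> verts G \<and> v \<in> verts G \<and> u \<noteq> v \<and> \<not> u \<rightarrow>\<^bsub>G\<^esub> v"
  by (auto simp: complement_def arcs_ends_def arc_to_ends_def image_iff)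

lemma complement_graph:
  assumes "graph G"
  shows "graph (complement G)"
proof -
  interpret graph G by (rule assms)
  have symG: "v \<rightarrow>\<^bsub>G\<^esub> u" if "u \<rightarrow>\<^bsub>G\<^esub> v" for u v
    using that by (rule arcs_ends_symmetric[OF sym_arcs])
  have S: "symmetric (complement G)"
    unfolding symmetric_def
  proof (rule symI)
    fix u v
    assume "u \<rightarrow>\<^bsub>complement G\<^esub> v"
    then have "u \<in> verts G" "v \<in> verts G" "u \<noteq> v" "\<not> u \<rightarrow>\<^bsub>G\<^esub> v"
      unfolding adj_complement_iff by simp_all
    moreover from this(4) have "\<not> v \<rightarrow>\<^bsub>G\<^esub> u"
      using symG[of v u] by (rule contrapos_nn)
    ultimately show "v \<rightarrow>\<^bsub>complement G\<^esub> u"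
      unfolding adj_complement_iff by simp
  qed
  have "arcs (complement G) \<subseteq> verts G \<times> verts G"
    by (auto simp: complement_def)
  then have F: "finite (arcs (complement G))"
    by (rule finite_subset) simp
  show ?thesis
  proof
    show "finite (arcs (complement G))" by (rule F)
    show "symmetric (complement G)" by (rule S)
  qed (simp_all add: complement_def arc_to_ends_def split_beta)
qed

lemma co_duplicates_iff:
  assumes "graph G"
  shows "co_duplicates G u v \<longleftrightarrow>
    u \<noteq> v \<and> u \<rightarrow>\<^bsub>G\<^esub> v \<and> neighbours G u - {v} = neighbours G v - {u}"
proof -
  interpret graph G by (rule assms)
  have s: "u \<rightarrow>\<^bsub>G\<^esub> v \<Longrightarrow> v \<rightarrow>\<^bsub>G\<^esub> u"
    by (rule arcs_ends_symmetric[OF sym_arcs])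
  have i: "\<not> w \<rightarrow>\<^bsub>G\<^esub> w" for w
    using adj_not_same by blast
  have V: "u \<rightarrow>\<^bsub>G\<^esub> v \<Longrightarrow> u \<in> verts G" "u \<rightarrow>\<^bsub>G\<^esub> v \<Longrightarrow> v \<in> verts G"
    by (auto dest: adj_in_verts)
  have vc: "verts (complement G) = verts G"
    by (simp add: complement_def)
  have "co_duplicates G u v \<longleftrightarrow> u \<noteq> v \<and> u \<rightarrow>\<^bsub>G\<^esub> v \<and>
      (\<forall>w \<in> verts G. (u \<noteq> w \<and> \<not> u \<rightarrow>\<^bsub>G\<^esub> w) \<longleftrightarrow> (v \<noteq> w \<and> \<not> v \<rightarrow>\<^bsub>G\<^esub> w))"
    unfolding co_duplicates_def duplicates_def neighbours_def adj_complement_iff vc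
    using V by (auto simp: set_eq_iff)
  also have "\<dots> \<longleftrightarrow> u \<noteq> v \<and> u \<rightarrow>\<^bsub>G\<^esub> v \<and> neighbours G u - {v} = neighbours G v - {u}"
    unfolding neighbours_def using s i[of u] i[of v] by auto
  finally show ?thesis .
qed

end

theory Submission
  imports Defs
begin

text \<open>
  Columns 1 and 2 of \<open>M = \<lambda>I - A\<close> agree in all rows other than the first two, so their difference is
  \<open>(\<lambda> + a) (e\<^sub>1 - e\<^sub>2)\<close>. Multiplying this by the first row of \<open>adj M\<close> and using
  \<open>adj M \<cdot> M = det M \<cdot> I\<close> gives the formula, because the (1,1) entry of \<open>adj M\<close> is the characteristic
  polynomial of the graph without \<open>v\<^sub>1\<close>.
\<close>

text \<open>Removing a row and the column of equal index keeps the remaining diagonal entries on the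
  diagonal, so the \<open>\<lambda>I\<close> part restricts to the smaller identity.\<close>

lemma mat_delete_char_poly_matrix:
  assumes "A \<in> carrier_mat n n" and "i < n"
  shows "mat_delete (char_poly_matrix A) i i = char_poly_matrix (mat_delete A i i)"
  using assms
  by (intro eq_matI) (auto simp: char_poly_matrix_def mat_delete_def)

lemma det_eq_adj_mat_of_columns:
  fixes M :: "'r :: comm_ring_1 mat"
  assumes M: "M \<in> carrier_mat n n" and n: "1 < n"
    and col: "\<And>i. i < n \<Longrightarrow> M $$ (i, 0) - M $$ (i, 1) = (if i = 0 then c else if i = 1 then - c else 0)"
  shows "det M = c * (adj_mat M $$ (0, 0) - adj_mat M $$ (0, 1))"
proof -
  let ?B = "adj_mat M"
  have B: "?B \<in> carrier_mat n n" and BM: "?B * M = det M \<cdot>\<^sub>m 1\<^sub>m n"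
    using adj_mat[OF M] by auto
  have entry: "(?B * M) $$ (0, j) = (\<Sum>i<n. ?B $$ (0, i) * M $$ (i, j))" if "j < n" for j
    using that n B M by (auto simp: scalar_prod_def lessThan_atLeast0)
  \<comment> \<open>Row 0 of \<open>det M \<cdot>\<^sub>m 1\<^sub>m n\<close> has
    \<open>det M\<close> in column 0 and 0 in column 1.\<close>
  have "det M = (?B * M) $$ (0, 0) - (?B * M) $$ (0, 1)"
    using n by (simp add: BM)
  also have "\<dots> = (\<Sum>i<n. ?B $$ (0, i) * (M $$ (i, 0) - M $$ (i, 1)))"
    using n by (simp add: entry sum_subtractf right_diff_distrib)
  also have "\<dots> = (\<Sum>i<n. ?B $$ (0, i) * (if i = 0 then c else if i = 1 then - c else 0))"
    by (intro sum.cong refl) (simp only: lessThan_iff col)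
  also have "\<dots> = (\<Sum>i\<in>{0, 1}. ?B $$ (0, i) * (if i = 0 then c else if i = 1 then - c else 0))"
    using n by (intro sum.mono_neutral_right) auto
  also have "\<dots> = c * (?B $$ (0, 0) - ?B $$ (0, 1))"
    by (simp add: algebra_simps)
  finally show ?thesis .
qed

lemma (in pre_digraph) adj_del_vert_iff:
  assumes "u \<noteq> x" and "v \<noteq> x"
  shows "u \<rightarrow>\<^bsub>del_vert x\<^esub> v \<longleftrightarrow> u \<rightarrow>\<^bsub>G\<^esub> v"
  using assms
  by (auto simp: arcs_ends_def arc_to_ends_def arcs_del_vert tail_del_vert head_del_vert image_iff)

text \<open>Distinctness keeps \<open>v\<close> out of \<open>vs\<close>, so every entry that
  survives concerns two vertices other than \<open>v\<close>, whose adjacency is untouched by the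
  deletion.\<close>

lemma mat_delete_adjacency_matrix:
  assumes "distinct (v # vs)"
  shows "mat_delete (adjacency_matrix G (v # vs)) 0 0 =
    adjacency_matrix (pre_digraph.del_vert G v) vs"
proof (rule eq_matI)
  fix i j
  assume "i < dim_row (adjacency_matrix (pre_digraph.del_vert G v) vs)"
    and "j < dim_col (adjacency_matrix (pre_digraph.del_vert G v) vs)"
  then have ij: "i < length vs" "j < length vs"
    by (simp_all add: adjacency_matrix_def)
  then have "vs ! i \<noteq> v" "vs ! j \<noteq> v"
    using assms by auto
  then show "mat_delete (adjacency_matrix G (v # vs)) 0 0 $$ (i, j) =
      adjacency_matrix (pre_digraph.del_vert G v) vs $$ (i, j)"
    using ij by (simp add: mat_delete_def adjacency_matrix_def pre_digraph.adj_del_vert_iff)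
qed (simp_all add: adjacency_matrix_def mat_delete_def)

lemma twins_adj_iff:
  assumes "graph G" and "twins G u v" and "w \<noteq> u" and "w \<noteq> v"
  shows "w \<rightarrow>\<^bsub>G\<^esub> u \<longleftrightarrow> w \<rightarrow>\<^bsub>G\<^esub> v"
proof -
  interpret graph G by fact
  have sym: "x \<rightarrow>\<^bsub>G\<^esub> y \<longleftrightarrow> y \<rightarrow>\<^bsub>G\<^esub> x" for x y
    using arcs_ends_symmetric[OF sym_arcs] by blast
  \<comment> \<open>This form covers both kinds of twins. For duplicates the removals change
    nothing: \<open>v\<close> is not adjacent to \<open>u\<close>, and \<open>u\<close> is not its
    own neighbour.\<close>
  have "neighbours G u - {v} = neighbours G v - {u}"
    using assms(2) co_duplicates_iff[OF assms(1), of u v] adj_not_same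
    unfolding twins_def by (auto simp: duplicates_def neighbours_def)
  then have "w \<in> neighbours G u \<longleftrightarrow> w \<in> neighbours G v"
    using assms(3,4) by blast
  then show ?thesis
    using adj_in_verts sym[of w] by (auto simp: neighbours_def)
qed

theorem theorem8:
  fixes G :: "('a, 'b) pre_digraph"
    and vs ws :: "'a list"
    and v1 v2 :: 'a
    and a :: real
    and A :: "real mat"
    and h :: "real poly"
  assumes "graph G"
    and "connected G"
    and "vertex_labelling G vs"
    and "vs = v1 # v2 # ws"
    and "twins G v1 v2"
    and "duplicates G v1 v2 \<Longrightarrow> a = 0"
    and "co_duplicates G v1 v2 \<Longrightarrow> a = 1"
    and "A = adjacency_matrix G vs"
    and "h = adj_mat (char_poly_matrix A) $$ (0, 1)"
  shows "char_poly A =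
    [:a, 1:] * (char_poly (adjacency_matrix (pre_digraph.del_vert G v1) (v2 # ws)) - h)"
proof -
  interpret graph G by fact
  let ?n = "length vs" and ?M = "char_poly_matrix A"
  have dist: "distinct (v1 # v2 # ws)"
    using assms(3,4) by (simp add: vertex_labelling_def)
  have n: "?n = Suc (Suc (length ws))"
    by (simp add: assms(4))
  have A: "A \<in> carrier_mat ?n ?n"
    by (simp add: assms(8) adjacency_matrix_def)
  have M: "?M \<in> carrier_mat ?n ?n"
    using A by simp
  have loop: "\<not> x \<rightarrow>\<^bsub>G\<^esub> x" for x
    using adj_not_same by blast
  have "v1 \<rightarrow>\<^bsub>G\<^esub> v2 \<longleftrightarrow> v2 \<rightarrow>\<^bsub>G\<^esub> v1"
    using arcs_ends_symmetric[OF sym_arcs] by blast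
  \<comment> \<open>Duplicates are non-adjacent and co-duplicates adjacent, so \<open>a\<close> is
    the off-diagonal entry of the block of the two twins.\<close>
  moreover have "a = (if v1 \<rightarrow>\<^bsub>G\<^esub> v2 then 1 else 0)"
    using assms(5-7) by (auto simp: twins_def duplicates_def[of G] co_duplicates_def)
  ultimately have top: "A $$ (0, 0) = 0" "A $$ (0, 1) = a" "A $$ (1, 0) = a" "A $$ (1, 1) = 0"
    by (simp_all add: assms(4,8) adjacency_matrix_def loop)
  have rest: "A $$ (i, 0) = A $$ (i, 1)" if "1 < i" "i < ?n" for i
  proof -
    have "vs ! i \<noteq> vs ! 0" "vs ! i \<noteq> vs ! 1"
      using that dist unfolding assms(4)[symmetric] by (simp_all add: nth_eq_iff_index_eq n)
    then have "vs ! i \<noteq> v1" "vs ! i \<noteq> v2"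
      by (simp_all add: assms(4))
    from twins_adj_iff[OF assms(1,5) this] that show ?thesis
      by (simp add: assms(4,8) adjacency_matrix_def)
  qed
  \<comment> \<open>The polynomial \<open>[:a, 1:]\<close> is \<lambda> + a. The top block of
    \<open>?M\<close> has \<lambda> on its diagonal and -a off it, so its two rows give \<lambda> -
    (-a) and -a - \<lambda>.\<close>
  have "?M $$ (i, 0) - ?M $$ (i, 1) =
      (if i = 0 then [:a, 1:] else if i = 1 then - [:a, 1:] else 0)" if "i < ?n" for i
  proof -
    consider "i = 0" | "i = 1" | "1 < i" by linarith
    then show ?thesis
      using that n A top rest[of i]
      by cases (simp_all add: char_poly_matrix_def)
  qed
  from det_eq_adj_mat_of_columns[OF M _ this]
  have "char_poly A = [:a, 1:] * (adj_mat ?M $$ (0, 0) - h)"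
    by (simp add: char_poly_def n assms(9))
  \<comment> \<open>On the diagonal the transposition in the adjugate has no effect, and the
    cofactor sign at (0, 0) is 1.\<close>
  also have "adj_mat ?M $$ (0, 0) = det (mat_delete ?M 0 0)"
    using M n by (simp add: adj_mat_def cofactor_def)
  also have "mat_delete ?M 0 0 = char_poly_matrix (mat_delete A 0 0)"
    using mat_delete_char_poly_matrix[OF A] n by simp
  also have "mat_delete A 0 0 = adjacency_matrix (pre_digraph.del_vert G v1) (v2 # ws)"
    using mat_delete_adjacency_matrix[OF dist] by (simp add: assms(4,8))
  finally show ?thesis
    by (simp add: char_poly_def)
qed

end
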